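(* Let $z>0$, $t>0$ and $q=e^{-t}$. For any real $\alpha>1$ and any $x\in\mathbb{C}$, \[ L_\alpha(zx;q,z^\alpha)=\frac{(2\pi z^\alpha)^{1/2}e^{\frac{\alpha t}{8}+\frac{\alpha}{2t}(\log z)^2}}{(\alpha t)^{1/2}(zx;q)_\infty}\sum_{n\in\mathbb{Z}} L_{1-1/\alpha}\!\left(q;q,-e^{2\pi i n/\alpha}x\,q^{\frac12(1-\frac1\alpha)}\right)e^{2\pi i n\left(\frac12-\frac1t\log z\right)-\frac{2\pi^2n^2}{\alpha t}}. \]
   Context: For $a\in\mathbb{C}$, $(a;q)_\infty=\prod_{j\ge0}(1-aq^j)$, and for real $c$, $(a;q)_c:=(a;q)_\infty/(aq^c;q)_\infty$; in particular for integers $n\ge1$, $(a;q)_{-n}=1/\prod_{j=1}^{n}(1-aq^{-j})$ and $1/(q;q)_{-n}=0$. Real powers are $q^c=e^{-ct}$. For real $\beta$ and $u,w\in\mathbb{C}$, $L_\beta(u;q,w):=\sum_{n\in\mathbb{Z}}\frac{w^nq^{\beta\binom n2}}{(u;q)_n}$ whenever the series converges; in particular $L_\beta(q;q,w)=\sum_{n\ge0}\frac{w^nq^{\beta\binom n2}}{(q;q)_n}$. *)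

theory Defs
  imports "HOL-Analysis.Analysis"
begin

definition qpoch_inf :: "complex \<Rightarrow> real \<Rightarrow> complex" where
  "qpoch_inf a q = (\<Prod>j. 1 - a * of_real q ^ j)"

text \<open>
  If \<open>a q\<^sup>c\<close> is a zero of the infinite product, the quotient below is \<open>y / 0 = 0\<close>; its reciprocal is
  then \<open>0\<close> as well, which agrees with the convention \<open>1 / (q;q)\<^bsub>-n\<^esub> = 0\<close> for \<open>n \<ge> 1\<close>.
  If \<open>a\<close> itself is a zero, every \<open>qpoch a q c\<close> is \<open>0\<close>, hence so is every summand \<open>L_term \<beta> a q w n\<close>.
\<close>

definition qpoch :: "complex \<Rightarrow> real \<Rightarrow> real \<Rightarrow> complex" where
  "qpoch a q c = qpoch_inf a q / qpoch_inf (a * of_real (q powr c)) q"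

definition L_term :: "real \<Rightarrow> complex \<Rightarrow> real \<Rightarrow> complex \<Rightarrow> int \<Rightarrow> complex" where
  "L_term \<beta> u q w n =
     w powi n * of_real (q powr (\<beta> * (of_int n gchoose 2))) / qpoch u q (of_int n)"

definition L_fun :: "real \<Rightarrow> complex \<Rightarrow> real \<Rightarrow> complex \<Rightarrow> complex" where
  "L_fun \<beta> u q w = (\<Sum>\<^sub>\<infinity>n\<in>UNIV. L_term \<beta> u q w n)"

end

theory Submission
  imports Defs "HOL-Probability.Characteristic_Functions" "HOL-Computational_Algebra.Polynomial"
begin

text \<open>
  Euler's expansion \<open>(y;q)\<^sub>\<infinity> = \<Sum>\<^sub>k (-1)\<^sup>k q\<^bsup>k(k-1)/2\<^esup> y\<^sup>k / (q;q)\<^sub>k\<close> at \<open>y = z x q\<^sup>n\<close> turns the left-hand side into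
  a double sum over \<open>n \<in> \<int>\<close>, \<open>k \<ge> 0\<close>, which converges absolutely because the quadratic form
  \<open>\<alpha> n\<^sup>2 + 2 n k + k\<^sup>2\<close> is positive definite for \<open>\<alpha> > 1\<close>. After summing over \<open>n\<close> first, the inner sum is
  a theta series; Jacobi inversion replaces it by a sum over \<open>m\<close> in which \<open>k\<close> occurs only through
  \<open>q\<^bsup>-k\<^sup>2/(2\<alpha>)\<^esup>\<close> and the phase \<open>e\<^bsup>2\<pi>imk/\<alpha>\<^esup>\<close>, and exchanging the sums once more gives the right-hand side.

  Jacobi inversion is proved by comparing Fourier coefficients: a continuous periodic function
  all of whose coefficients vanish is zero, by Stone--Weierstrass on the circle.
\<close>

section \<open>Uniqueness of Fourier coefficients\<close>

text \<open>On the unit circle \<open>cnj w = 1 / w\<close>, so polynomials in \<open>Re w\<close> and \<open>Im w\<close> are Laurent polynomials in \<open>w\<close>.\<close>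

lemma real_polynomial_function_on_circle:
  fixes p :: "complex \<Rightarrow> real"
  assumes "real_polynomial_function p"
  shows "\<exists>N P. \<forall>w. norm w = 1 \<longrightarrow> w ^ N * of_real (p w) = poly P (w::complex)"
  using assms
proof induction
  case (linear f)
  interpret bounded_linear f by fact
  \<comment> \<open>A real-linear \<open>f\<close> satisfies f w = Re w * f 1 + Im w * f i. On the
    circle, multiplication by \<open>w\<close> turns Re w into (w^2 + 1) / 2 and Im w into (w^2 - 1)
    / (2 i); \<open>c\<close> and \<open>d\<close> collect the resulting coefficients.\<close>
  define c d :: complex where "c = of_real (f 1) / 2" and "d = of_real (f \<i>) / (2 * \<i>)"
  define P where "P = smult c [:1, 0, 1:] + smult d [:-1, 0, 1:]"
  have "w ^ 1 * of_real (f w) = poly P w" if w: "norm w = 1" for w :: complex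
  proof -
    have "w = Re w *\<^sub>R 1 + Im w *\<^sub>R \<i>"
      by (simp add: complex_eq_iff)
    then have "f w = Re w * f 1 + Im w * f \<i>"
      by (metis add scaleR real_scaleR_def)
    moreover have "of_real (Re w) = (w + cnj w) / 2" "of_real (Im w) = (w - cnj w) / (2 * \<i>)"
      by (simp_all add: complex_eq_iff)
    moreover have "w * cnj w = 1"
      using w by (simp add: complex_mult_cnj cmod_def)
    ultimately have "w * of_real (Re w) = (w * w + 1) / 2" "w * of_real (Im w) = (w * w - 1) / (2 * \<i>)"
      by (simp_all only: times_divide_eq_right distrib_left right_diff_distrib)
    then have "w * of_real (f w) = (w * w + 1) / 2 * of_real (f 1) + (w * w - 1) / (2 * \<i>) * of_real (f \<i>)"
      using \<open>f w = _\<close> by (simp only: of_real_add of_real_mult distrib_left mult.assoc[symmetric])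
    also have "\<dots> = c * (w * w + 1) + d * (w * w - 1)"
      by (simp add: c_def d_def mult_ac)
    finally show ?thesis
      by (simp add: P_def algebra_simps)
  qed
  then show ?case by blast
next
  case (const c)
  have "\<forall>w. norm w = 1 \<longrightarrow> w ^ 0 * of_real c = poly [:of_real c:] (w::complex)" by simp
  then show ?case by blast
next
  case (add f g)
  then obtain N P M Q where
    N: "\<And>w. norm w = 1 \<Longrightarrow> w ^ N * of_real (f w) = poly P w" and
    M: "\<And>w. norm w = 1 \<Longrightarrow> w ^ M * of_real (g w) = poly Q w" by blast
  have "w ^ (N + M) * of_real (f w + g w) = poly (monom 1 M * P + monom 1 N * Q) w"
    if "norm w = 1" for w
    using N[OF that, symmetric] M[OF that, symmetric]
    by (simp add: poly_monom power_add algebra_simps)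
  then show ?case by blast
next
  case (mult f g)
  then obtain N P M Q where
    N: "\<And>w. norm w = 1 \<Longrightarrow> w ^ N * of_real (f w) = poly P w" and
    M: "\<And>w. norm w = 1 \<Longrightarrow> w ^ M * of_real (g w) = poly Q w" by blast
  have "w ^ (N + M) * of_real (f w * g w) = poly (P * Q) w" if "norm w = 1" for w
    using N[OF that, symmetric] M[OF that, symmetric]
    by (simp add: power_add algebra_simps)
  then show ?case by blast
qed

text \<open>Vanishing coefficients make \<open>f\<close> integrate to 0 against every Laurent
  polynomial on the circle. Approximating the conjugate of \<open>f\<close> uniformly by such
  polynomials shows that the integral of |f|^2 is 0.\<close>

lemma continuous_eq_0_if_fourier_coeffs_0:
  fixes f :: "real \<Rightarrow> complex"
  assumes cont: "continuous_on {0..1} f" and per: "f 0 = f 1"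
    and coeffs: "\<And>m::int. ((\<lambda>s. f s * cis (2 * pi * of_int m * s)) has_integral 0) {0..1}"
    and s: "s \<in> {0..1}"
  shows "f s = 0"
proof -
  define h where "h = cnj \<circ> f \<circ> (\<lambda>z. Arg2pi z / (2 * pi))"
  \<comment> \<open>\<open>Arg2pi\<close> jumps at the point 1, so continuity of \<open>h\<close>
    there rests on f 0 = f 1. The loop, homotopic to itself, is passed to the fact that homotopic
    loops induce homotopic, hence continuous, maps of the circle.\<close>
  have "path (cnj \<circ> f)"
    using cont by (auto simp: path_def o_def intro!: continuous_intros)
  then have "homotopic_loops UNIV (cnj \<circ> f) (cnj \<circ> f)"
    using per by (simp add: homotopic_loops_refl pathstart_def pathfinish_def)
  then have h_cont: "continuous_on (sphere 0 1) h"
    using homotopic_loops_imp_homotopic_circlemaps homotopic_with_imp_continuous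
    unfolding h_def by blast
  have h_cis: "h (cis (2 * pi * s)) = cnj (f s)" if "s \<in> {0..1}" for s
  proof (cases "s = 1")
    case True
    then show ?thesis using per Arg2pi_of_real[of 1] by (simp add: h_def)
  next
    case False
    then have "Arg2pi (cis (2 * pi * s)) = 2 * pi * s"
      using that by (simp add: cis_conv_exp Arg2pi_exp)
    then show ?thesis by (simp add: h_def)
  qed
  have poly0: "((\<lambda>s. f s * of_real (p (cis (2 * pi * s)))) has_integral 0) {0..1}"
    if p: "real_polynomial_function p" for p
  proof -
    obtain N P where NP: "\<And>w. norm w = 1 \<Longrightarrow> w ^ N * of_real (p w) = poly P w"
      using real_polynomial_function_on_circle[OF p] by blast
    \<comment> \<open>Dividing the polynomial \<open>P\<close> by w^N produces frequencies i - N of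
      either sign, which is why \<open>coeffs\<close> ranges over all integers.\<close>
    have "f s * of_real (p (cis (2 * pi * s))) =
        (\<Sum>i\<le>degree P. coeff P i * (f s * cis (2 * pi * of_int (int i - int N) * s)))" for s
    proof -
      define w where "w = cis (2 * pi * s)"
      have "of_real (p w) = inverse (w ^ N) * (w ^ N * of_real (p w))"
        by (simp add: w_def)
      also have "\<dots> = inverse (w ^ N) * poly P w"
        by (simp add: NP w_def)
      also have "\<dots> = (\<Sum>i\<le>degree P. coeff P i * (w ^ i * inverse (w ^ N)))"
        by (simp add: poly_altdef sum_distrib_left sum_distrib_right mult_ac)
      also have "(\<lambda>i. w ^ i * inverse (w ^ N)) = (\<lambda>i. cis (2 * pi * of_int (int i - int N) * s))"
        by (simp add: w_def Complex.DeMoivre cis_mult algebra_simps fun_eq_iff)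
      finally show ?thesis
        by (simp add: w_def sum_distrib_left mult_ac)
    qed
    moreover have "((\<lambda>s. \<Sum>i\<le>degree P. coeff P i * (f s * cis (2 * pi * of_int (int i - int N) * s)))
        has_integral (\<Sum>i\<le>degree P. coeff P i * 0)) {0..1}"
      by (intro has_integral_sum has_integral_mult_right coeffs) auto
    ultimately show ?thesis by simp
  qed
  have poly0': "((\<lambda>s. f s * g (cis (2 * pi * s))) has_integral 0) {0..1}"
    if "polynomial_function g" for g
  proof -
    have "real_polynomial_function (Re \<circ> g)" "real_polynomial_function (Im \<circ> g)"
      using that bounded_linear_Re bounded_linear_Im unfolding polynomial_function_def by auto
    then have "((\<lambda>s. f s * of_real ((Re \<circ> g) (cis (2 * pi * s))) +
          \<i> * (f s * of_real ((Im \<circ> g) (cis (2 * pi * s))))) has_integral 0 + \<i> * 0) {0..1}"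
      by (intro has_integral_add has_integral_mult_right poly0)
    moreover have "f s * of_real ((Re \<circ> g) (cis (2 * pi * s))) +
          \<i> * (f s * of_real ((Im \<circ> g) (cis (2 * pi * s)))) = f s * g (cis (2 * pi * s))" for s
      by (simp add: complex_eq_iff algebra_simps)
    ultimately show ?thesis by simp
  qed
  have "bounded (f ` {0..1})"
    using cont compact_continuous_image compact_imp_bounded by blast
  then obtain B where B: "B > 0" "\<And>s. s \<in> {0..1} \<Longrightarrow> norm (f s) \<le> B"
    unfolding bounded_pos by blast
  define I where "I = integral {0..1} (\<lambda>s. f s * cnj (f s))"
  have I: "((\<lambda>s. f s * cnj (f s)) has_integral I) {0..1}"
    unfolding I_def by (intro integrable_integral integrable_continuous_real continuous_intros cont)
  have "norm I \<le> e" if "e > 0" for e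
  proof -
    \<comment> \<open>Since |f| is at most \<open>B\<close>, an error of e / B in approximating the
      conjugate leaves an integrand of norm at most \<open>e\<close>.\<close>
    from that B(1) have "e / B > 0" by simp
    from Stone_Weierstrass_polynomial_function[OF compact_sphere h_cont this]
    obtain g where g: "polynomial_function g" "\<And>w. w \<in> sphere 0 1 \<Longrightarrow> norm (h w - g w) < e / B"
      by blast
    have "((\<lambda>s. f s * cnj (f s) - f s * g (cis (2 * pi * s))) has_integral I - 0) {0..1}"
      by (intro has_integral_diff I poly0' g)
    then have hi: "((\<lambda>s. f s * (cnj (f s) - g (cis (2 * pi * s)))) has_integral I) (cbox 0 1)"
      by (simp add: algebra_simps)
    have "norm (f s * (cnj (f s) - g (cis (2 * pi * s)))) \<le> B * (e / B)" if "s \<in> cbox 0 1" for s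
      unfolding norm_mult
    proof (rule mult_mono)
      show "norm (f s) \<le> B" using B(2)[of s] that by simp
      show "norm (cnj (f s) - g (cis (2 * pi * s))) \<le> e / B"
        using g(2)[of "cis (2 * pi * s)"] h_cis[of s] that by simp
    qed (use B in auto)
    from has_integral_bound[OF _ hi this] show ?thesis
      using B that by simp
  qed
  then have "I = 0"
    by (metis dense_ge norm_le_zero_iff)
  have "((\<lambda>s. (norm (f s))\<^sup>2) has_integral Re I) {0..1}"
    using has_integral_linear[OF I bounded_linear_Re]
    by (simp add: o_def complex_mult_cnj cmod_power2)
  with \<open>I = 0\<close> have "((\<lambda>s. (norm (f s))\<^sup>2) has_integral 0) (cbox 0 1)" by simp
  then have "(norm (f s))\<^sup>2 = 0"
    by (rule has_integral_0_cbox_imp_0[rotated 2]) (use s cont in \<open>auto intro!: continuous_intros\<close>)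
  then show ?thesis by simp
qed

section \<open>Jacobi inversion of theta series\<close>

text \<open>A rescaling of the characteristic function of the standard normal law: c = sqrt (2 a)
  turns - (c u)^2 / 2 into - a u^2, and v = y / c restores the frequency \<open>y\<close>.\<close>

lemma has_bochner_integral_gaussian_cis:
  fixes a y :: real
  assumes a: "a > 0"
  shows "has_bochner_integral lborel (\<lambda>u. of_real (exp (- a * u\<^sup>2)) * cis (y * u))
           (of_real (sqrt (pi / a) * exp (- y\<^sup>2 / (4 * a))))"
proof -
  define c where "c = sqrt (2 * a)"
  have c: "c > 0" "c\<^sup>2 = 2 * a" using a by (simp_all add: c_def)
  define v where "v = y / c"
  define f where "f = (\<lambda>u. std_normal_density u *\<^sub>R iexp (v * u))"
  have f_int: "integrable lborel f"
  proof (rule Bochner_Integration.integrable_bound)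
    show "integrable lborel std_normal_density" by (rule integrable_normal_density) simp
  qed (auto simp: f_def)
  have "integral\<^sup>L lborel f = char std_normal_distribution v"
    unfolding char_def f_def by (subst integral_density) auto
  also have "\<dots> = of_real (exp (- v\<^sup>2 / 2))"
    by (simp add: char_std_normal_distribution)
  finally have "c *\<^sub>R (\<integral>u. f (0 + c * u) \<partial>lborel) = of_real (exp (- v\<^sup>2 / 2))"
    using lborel_integral_real_affine[of c f 0] c by simp
  then have f_eq: "(\<integral>u. f (0 + c * u) \<partial>lborel) = of_real (exp (- v\<^sup>2 / 2) / c)"
    using c by (simp add: field_simps scaleR_conv_of_real)
  have "has_bochner_integral lborel (\<lambda>u. f (0 + c * u)) (of_real (exp (- v\<^sup>2 / 2) / c))"
    using lborel_integrable_real_affine[OF f_int, of c 0] c f_eq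
    by (simp add: has_bochner_integral_iff)
  then have "has_bochner_integral lborel (\<lambda>u. of_real (sqrt (2 * pi)) * f (0 + c * u))
      (of_real (sqrt (2 * pi)) * of_real (exp (- v\<^sup>2 / 2) / c))"
    by (rule has_bochner_integral_mult_right)
  moreover have "of_real (sqrt (2 * pi)) * f (0 + c * u) = of_real (exp (- a * u\<^sup>2)) * cis (y * u)" for u
  proof -
    have "v * (c * u) = y * u" "- (c * u)\<^sup>2 / 2 = - a * u\<^sup>2"
      using c by (simp_all add: v_def power_mult_distrib)
    moreover have "f (0 + c * u) = of_real (1 / sqrt (2 * pi) * exp (- (c * u)\<^sup>2 / 2)) * cis (v * (c * u))"
      by (simp add: f_def std_normal_density_def cis_conv_exp scaleR_conv_of_real)
    ultimately have "f (0 + c * u) = of_real (1 / sqrt (2 * pi) * exp (- a * u\<^sup>2)) * cis (y * u)"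
      by (simp only:)
    then show ?thesis
      by (simp flip: of_real_mult)
  qed
  moreover have "sqrt (2 * pi) * (exp (- v\<^sup>2 / 2) / c) = sqrt (pi / a) * exp (- y\<^sup>2 / (4 * a))"
  proof -
    have "sqrt (2 * pi) / c = sqrt (pi / a)"
      using a by (simp add: c_def real_sqrt_divide[symmetric])
    moreover have "- v\<^sup>2 / 2 = - y\<^sup>2 / (4 * a)"
      using c by (simp add: v_def power_divide)
    ultimately show ?thesis by (metis times_divide_eq_left times_divide_eq_right)
  qed
  ultimately show ?thesis
    by (metis (no_types, lifting) of_real_mult has_bochner_integral_cong)
qed

text \<open>The unfolding step of Poisson summation: the translates of the unit interval tile
  [-N, N], and dominated convergence lets N grow.\<close>

lemma integral_translates_tendsto:
  fixes f :: "real \<Rightarrow> complex"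
  assumes cont: "continuous_on UNIV f" and int: "integrable lborel f"
  shows "(\<lambda>N. \<Sum>n = - int N..<int N. integral {0..1} (\<lambda>s. f (s + of_int n)))
           \<longlonglongrightarrow> integral\<^sup>L lborel f"
proof -
  have intg: "f integrable_on {x..y}" for x y
    by (intro integrable_continuous_real continuous_on_subset[OF cont]) auto
  have shift: "integral {0..1} (\<lambda>s. f (s + c)) = integral {c..c+1} f" for c
    using integral_shift[of 0 c 1 f] cont
    by (auto simp: o_def add.commute intro: continuous_on_subset)
  have eq: "(\<Sum>n = - int N..<int N. integral {0..1} (\<lambda>s. f (s + of_int n))) =
      (\<integral>u. indicator {- real N..real N} u *\<^sub>R f u \<partial>lborel)" for N
  proof -
    have "(\<Sum>n = - int N..<int N. integral {0..1} (\<lambda>s. f (s + of_int n))) = integral {- real N..real N} f"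
    proof (induction N)
      case (Suc N)
      \<comment> \<open>Passing from N to N + 1 adds the translates n = -N - 1 and n = N, that is,
        one unit interval at each end of [-N, N].\<close>
      have set: "{- int (Suc N)..<int (Suc N)} = insert (- int N - 1) (insert (int N) {- int N..<int N})"
        by auto
      define r where "r = real (Suc N)"
      define l where "l = - r"
      have l: "real_of_int (- int N - 1) = l" "l + 1 = - real N" and r: "real N + 1 = r"
        by (simp_all add: l_def r_def)
      have "integral {l..- real N} f + integral {- real N..real N} f = integral {l..real N} f"
        "integral {l..real N} f + integral {real N..r} f = integral {l..r} f"
        by (intro Henstock_Kurzweil_Integration.integral_combine intg; simp add: l_def r_def)+
      moreover have "(\<Sum>n = - int (Suc N)..<int (Suc N). integral {0..1} (\<lambda>s. f (s + of_int n))) =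
          integral {l..- real N} f + (integral {real N..r} f + integral {- real N..real N} f)"
        unfolding set Suc[symmetric] by (subst sum.insert; simp add: shift l r del: of_int_diff of_int_minus)+
      ultimately show ?case
        unfolding r_def[symmetric] l_def[symmetric] by (simp add: add_ac)
    qed simp
    also have "\<dots> = (\<integral>u. indicator {- real N..real N} u *\<^sub>R f u \<partial>lborel)"
      by (subst set_borel_integral_eq_integral(2)[symmetric])
         (auto simp: set_integrable_def set_lebesgue_integral_def intro: integrable_mult_indicator int)
    finally show ?thesis .
  qed
  have "(\<lambda>N. \<integral>u. indicator {- real N..real N} u *\<^sub>R f u \<partial>lborel) \<longlonglongrightarrow> (\<integral>u. f u \<partial>lborel)"
  proof (rule integral_dominated_convergence)
    show "integrable lborel (\<lambda>u. norm (f u))" using int by simp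
    show "AE u in lborel. (\<lambda>N. indicator {- real N..real N} u *\<^sub>R f u) \<longlonglongrightarrow> f u"
    proof (intro AE_I2 tendsto_eventually)
      fix u :: real
      have "\<forall>\<^sub>F N in sequentially. real N \<ge> \<bar>u\<bar>"
        using filterlim_real_sequentially by (simp add: filterlim_at_top)
      then show "\<forall>\<^sub>F N in sequentially. indicator {- real N..real N} u *\<^sub>R f u = f u"
        by eventually_elim (auto simp: indicator_def)
    qed
  qed (use int in \<open>auto simp: indicator_def intro!: borel_measurable_scaleR\<close>)
  then show ?thesis by (simp add: eq)
qed

text \<open>Lets an unordered sum over the integers be evaluated along the half-open ranges used for
  the tiling of [-N, N].\<close>

lemma symmetric_intervals_at_top:
  "filterlim (\<lambda>N. {- int N..<int N}) (finite_subsets_at_top UNIV) sequentially"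
  unfolding filterlim_finite_subsets_at_top
proof (intro allI impI)
  fix X :: "int set" assume "finite X \<and> X \<subseteq> UNIV"
  then have X: "finite X" by simp
  have "\<forall>\<^sub>F N in sequentially. N > nat (Max (insert 0 (abs ` X)))"
    by (rule eventually_gt_at_top)
  then show "\<forall>\<^sub>F N in sequentially. finite {- int N..<int N} \<and> X \<subseteq> {- int N..<int N} \<and> {- int N..<int N} \<subseteq> UNIV"
  proof eventually_elim
    case (elim N)
    have "\<bar>n\<bar> < int N" if "n \<in> X" for n
    proof -
      have "\<bar>n\<bar> \<le> Max (insert 0 (abs ` X))" using X that by (intro Max_ge) auto
      then show ?thesis using elim by linarith
    qed
    then show ?case by (force simp: abs_less_iff)
  qed
qed

text \<open>The majorant gives uniform convergence, so sum and integral commute. The common value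
  \<open>J\<close> stays abstract because it is identified differently in the two later uses: by a
  limit over translates and by orthogonality.\<close>

lemma has_integral_infsum_Weierstrass:
  fixes f :: "'a \<Rightarrow> real \<Rightarrow> 'b::banach"
  assumes cont: "\<And>n. continuous_on {a..b} (f n)"
    and bound: "\<And>n s. s \<in> {a..b} \<Longrightarrow> norm (f n s) \<le> M n"
    and M: "M summable_on UNIV"
  obtains J where "((\<lambda>s. \<Sum>\<^sub>\<infinity>n. f n s) has_integral J) {a..b}"
    and "((\<lambda>n. integral {a..b} (f n)) has_sum J) UNIV"
proof -
  have "uniform_limit {a..b} (\<lambda>X s. \<Sum>n\<in>X. f n s) (\<lambda>s. \<Sum>\<^sub>\<infinity>n. f n s) (finite_subsets_at_top UNIV)"
    by (rule Weierstrass_m_test_general[OF bound M])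
  then obtain I J where IJ: "\<And>X. ((\<lambda>s. \<Sum>n\<in>X. f n s) has_integral I X) {a..b}"
    "((\<lambda>s. \<Sum>\<^sub>\<infinity>n. f n s) has_integral J) {a..b}" "(I \<longlongrightarrow> J) (finite_subsets_at_top UNIV)"
    by (rule uniform_limit_integral) (auto intro!: continuous_intros cont)
  have "I X = (\<Sum>n\<in>X. integral {a..b} (f n))" if "finite X" for X
    using that integral_unique[OF IJ(1)[of X]]
    by (simp add: Henstock_Kurzweil_Integration.integral_sum integrable_continuous_real cont)
  then have "\<forall>\<^sub>F X in finite_subsets_at_top UNIV. I X = (\<Sum>n\<in>X. integral {a..b} (f n))"
    by (intro eventually_finite_subsets_at_top_weakI) auto
  with IJ(3) have "((\<lambda>n. integral {a..b} (f n)) has_sum J) UNIV"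
    unfolding has_sum_def by (rule Lim_transform_eventually)
  with IJ(2) show ?thesis by (rule that)
qed

lemma continuous_on_infsum_Weierstrass:
  fixes f :: "'a \<Rightarrow> 'c::topological_space \<Rightarrow> 'b::banach"
  assumes cont: "\<And>n. continuous_on S (f n)"
    and bound: "\<And>n s. s \<in> S \<Longrightarrow> norm (f n s) \<le> M n"
    and M: "M summable_on UNIV"
  shows "continuous_on S (\<lambda>s. \<Sum>\<^sub>\<infinity>n. f n s)"
  by (rule uniform_limit_theorem[OF _ Weierstrass_m_test_general[OF bound M]])
     (auto intro!: always_eventually continuous_intros cont)

section \<open>Gaussian majorants for sums over integers and naturals\<close>

lemma summable_on_exp_minus_abs_int: "(\<lambda>n::int. exp (- \<bar>of_int n\<bar> :: real)) summable_on UNIV"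
proof -
  have nat: "(\<lambda>n::nat. exp (- real n)) summable_on UNIV"
  proof (rule norm_summable_imp_summable_on)
    have "summable (\<lambda>n. exp (-1::real) ^ n)"
      by (rule summable_geometric) simp
    then show "summable (\<lambda>n. norm (exp (- real n)))"
      by (simp add: exp_of_nat_mult[symmetric])
  qed
  have "(\<lambda>n::int. exp (- \<bar>of_int n\<bar> :: real)) summable_on (range int \<union> range (\<lambda>n. - int n))"
  proof (rule summable_on_union)
    show "(\<lambda>n::int. exp (- \<bar>of_int n\<bar> :: real)) summable_on range int"
      by (subst summable_on_reindex) (use nat in \<open>auto simp: o_def\<close>)
    show "(\<lambda>n::int. exp (- \<bar>of_int n\<bar> :: real)) summable_on range (\<lambda>n. - int n)"
      by (subst summable_on_reindex) (use nat in \<open>auto simp: o_def inj_on_def\<close>)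
  qed
  moreover have "range int \<union> range (\<lambda>n. - int n) = UNIV"
    by (auto simp: image_iff) (metis int_cases2)
  ultimately show ?thesis by simp
qed

lemma summable_on_gaussian_int:
  fixes a b :: real
  assumes "a > 0"
  shows "(\<lambda>n::int. exp (b * \<bar>of_int n\<bar> - a * (of_int n)\<^sup>2)) summable_on UNIV"
proof (rule summable_on_comparison_test)
  show "(\<lambda>n::int. exp ((b + 1)\<^sup>2 / (4 * a)) * exp (- \<bar>of_int n\<bar> :: real)) summable_on UNIV"
    by (intro summable_on_cmult_right summable_on_exp_minus_abs_int)
  fix n :: int
  define u where "u = \<bar>real_of_int n\<bar>"
  \<comment> \<open>The square is completed for b + 1 instead of b, which leaves a spare -u in the
    exponent and so a geometric majorant.\<close>
  have "0 \<le> a * (u - (b + 1) / (2 * a))\<^sup>2" using assms by simp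
  also have "\<dots> = a * u\<^sup>2 - (b + 1) * u + (b + 1)\<^sup>2 / (4 * a)"
    using assms by (simp add: power2_eq_square field_simps)
  finally have "b * u - a * u\<^sup>2 \<le> (b + 1)\<^sup>2 / (4 * a) - u"
    by (simp add: algebra_simps)
  then show "exp (b * \<bar>of_int n\<bar> - a * (of_int n)\<^sup>2) \<le> exp ((b + 1)\<^sup>2 / (4 * a)) * exp (- \<bar>of_int n\<bar> :: real)"
    by (simp add: u_def flip: exp_add)
qed auto

lemma summable_on_gaussian_nat:
  fixes a b :: real
  assumes "a > 0"
  shows "(\<lambda>k::nat. exp (b * real k - a * (real k)\<^sup>2)) summable_on UNIV"
proof -
  have "(\<lambda>n::int. exp (b * \<bar>of_int n\<bar> - a * (of_int n)\<^sup>2)) summable_on range int"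
    using summable_on_gaussian_int[OF assms] by (rule summable_on_subset_banach) auto
  then show ?thesis by (subst (asm) summable_on_reindex) (auto simp: o_def)
qed

section \<open>Fourier coefficients and inversion of the theta series\<close>

lemma has_integral_cis_period:
  fixes k :: int
  shows "((\<lambda>s. cis (2 * pi * of_int k * s)) has_integral (if k = 0 then 1 else 0)) {0..1}"
proof (cases "k = 0")
  case True
  then show ?thesis using has_integral_const_real[of "1::complex" 0 1] by simp
next
  case False
  define c where "c = 2 * pi * of_int k"
  have c: "c \<noteq> 0" using False by (simp add: c_def)
  have "((\<lambda>s. cis (c * s)) has_integral cis (c * 1) / (\<i> * of_real c) - cis (c * 0) / (\<i> * of_real c)) {0..1}"
  proof (rule fundamental_theorem_of_calculus)
    fix s :: real
    show "((\<lambda>s. cis (c * s) / (\<i> * of_real c)) has_vector_derivative cis (c * s)) (at s within {0..1})"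
    proof -
      have "((\<lambda>w. exp (\<i> * of_real c * w) / (\<i> * of_real c)) has_field_derivative exp (\<i> * of_real c * of_real s))
          (at (of_real s))"
        using c by (auto intro!: derivative_eq_intros)
      from has_vector_derivative_real_field[OF this] show ?thesis
        by (simp add: cis_conv_exp mult.assoc)
    qed
  qed simp
  moreover have "cis (c * 1) = 1"
    unfolding c_def by (simp add: cis_multiple_2pi)
  ultimately show ?thesis using False by (simp add: c_def)
qed

text \<open>As functions of \<open>s\<close> both sides are continuous, have period 1 and have the
  same Fourier coefficients.\<close>

lemma theta_inversion_shift:
  fixes a s :: real
  assumes a: "a > 0"
  shows "(\<Sum>\<^sub>\<infinity>n::int. of_real (exp (- a * (s + of_int n)\<^sup>2))) =
         (\<Sum>\<^sub>\<infinity>m::int. of_real (sqrt (pi / a) * exp (- (pi * of_int m)\<^sup>2 / a)) * cis (2 * pi * of_int m * s))"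
proof -
  define \<phi> where "\<phi> = (\<lambda>(n::int) s. of_real (exp (- a * (s + of_int n)\<^sup>2)) :: complex)"
  define c where "c = (\<lambda>m::int. sqrt (pi / a) * exp (- (pi * of_int m)\<^sup>2 / a))"
  define \<psi> where "\<psi> = (\<lambda>(m::int) s. of_real (c m) * cis (2 * pi * of_int m * s) :: complex)"
  define F where "F = (\<lambda>s. \<Sum>\<^sub>\<infinity>n. \<phi> n s)"
  define G where "G = (\<lambda>s. \<Sum>\<^sub>\<infinity>m. \<psi> m s)"
  define M where "M = (\<lambda>n::int. exp a * exp (0 * \<bar>of_int n\<bar> - (a / 2) * (of_int n)\<^sup>2))"
  have M: "M summable_on UNIV"
    unfolding M_def by (intro summable_on_cmult_right summable_on_gaussian_int) (use a in simp)
  have \<phi>_le: "norm (\<phi> n s) \<le> M n" if "s \<in> {0..1}" for n s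
  proof -
    \<comment> \<open>This square is 2 (s + n)^2 + 2 s^2 - n^2. Hence half of the Gaussian rate and
      the constant exp a in \<open>M\<close> absorb any shift \<open>s\<close> in the unit
      interval.\<close>
    have "0 \<le> (2 * s + of_int n)\<^sup>2" by simp
    then have "(of_int n)\<^sup>2 \<le> 2 * (s + of_int n)\<^sup>2 + 2 * s\<^sup>2"
      by (simp add: power2_eq_square algebra_simps)
    moreover have "s\<^sup>2 \<le> 1" using that by (simp add: power_le_one_iff)
    ultimately have "(of_int n)\<^sup>2 / 2 - 1 \<le> (s + of_int n)\<^sup>2" by linarith
    from mult_left_mono[OF this, of a] a have "- a * (s + of_int n)\<^sup>2 \<le> a - (a / 2) * (of_int n)\<^sup>2"
      by (simp add: algebra_simps)
    then show ?thesis
      unfolding \<phi>_def M_def by (simp flip: exp_add)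
  qed
  have c: "c summable_on UNIV"
  proof -
    have "(\<lambda>n::int. sqrt (pi / a) * exp (0 * \<bar>of_int n\<bar> - (pi\<^sup>2 / a) * (of_int n)\<^sup>2)) summable_on UNIV"
      by (intro summable_on_cmult_right summable_on_gaussian_int) (use a in simp)
    then show ?thesis by (simp add: c_def power_mult_distrib)
  qed
  have \<psi>_le: "norm (\<psi> m s) \<le> c m" for m s
    using a by (simp add: \<psi>_def c_def norm_mult)
  have F_cont: "continuous_on {0..1} F"
    unfolding F_def
    by (rule continuous_on_infsum_Weierstrass[OF _ \<phi>_le M]) (auto simp: \<phi>_def intro!: continuous_intros)
  have G_cont: "continuous_on {0..1} G"
    unfolding G_def
    by (rule continuous_on_infsum_Weierstrass[OF _ \<psi>_le c]) (auto simp: \<psi>_def intro!: continuous_intros)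
  have F_period: "F (s + of_int k) = F s" for s k
    unfolding F_def \<phi>_def
    by (rule infsum_reindex_bij_witness[of _ "\<lambda>n. n - k" "\<lambda>n. n + k"]) (auto simp: algebra_simps)
  have G_period: "G (s + of_int k) = G s" for s k
  proof -
    have "\<psi> m (s + of_int k) = \<psi> m s" for m
    proof -
      have "2 * pi * of_int m * (s + of_int k) = 2 * pi * of_int m * s + 2 * pi * of_int (m * k)"
        by (simp add: algebra_simps)
      then show ?thesis
        by (simp add: \<psi>_def cis_multiple_2pi flip: cis_mult)
    qed
    then show ?thesis by (simp add: G_def)
  qed
  have F_coeff: "((\<lambda>s. F s * cis (2 * pi * of_int m * s)) has_integral of_real (c m)) {0..1}" for m
  proof -
    define h where "h = (\<lambda>u. of_real (exp (- a * u\<^sup>2)) * cis (2 * pi * of_int m * u))"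
    have h: "has_bochner_integral lborel h (of_real (c m))"
      using has_bochner_integral_gaussian_cis[OF a, of "2 * pi * of_int m"]
      by (simp add: h_def c_def power_mult_distrib)
    \<comment> \<open>The character does not see integer shifts, so the summands are the translates
      of one function on the line, whose integral is the Gaussian transform.\<close>
    have h_eq: "\<phi> n s * cis (2 * pi * of_int m * s) = h (s + of_int n)" for n s
    proof -
      have "2 * pi * of_int m * (s + of_int n) = 2 * pi * of_int m * s + 2 * pi * of_int (m * n)"
        by (simp add: algebra_simps)
      then show ?thesis
        by (simp add: h_def \<phi>_def cis_multiple_2pi flip: cis_mult)
    qed
    have h_le: "norm (h (s + of_int n)) \<le> M n" if "s \<in> {0..1}" for n s
      using \<phi>_le[OF that, of n] by (simp add: norm_mult flip: h_eq)
    have h_cont: "continuous_on S h" for S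
      unfolding h_def by (intro continuous_intros)
    have h_cont': "continuous_on {0..1} (\<lambda>s. h (s + of_int n))" for n
      unfolding h_def by (intro continuous_intros)
    obtain J where J: "((\<lambda>s. \<Sum>\<^sub>\<infinity>n::int. h (s + of_int n)) has_integral J) {0..1}"
      "((\<lambda>n::int. integral {0..1} (\<lambda>s. h (s + of_int n))) has_sum J) UNIV"
      by (rule has_integral_infsum_Weierstrass[OF h_cont' h_le M])
    have "(\<lambda>N. \<Sum>n = - int N..<int N. integral {0..1} (\<lambda>s. h (s + of_int n))) \<longlonglongrightarrow> J"
      using filterlim_compose[OF J(2)[unfolded has_sum_def] symmetric_intervals_at_top] .
    moreover have "(\<lambda>N. \<Sum>n = - int N..<int N. integral {0..1} (\<lambda>s. h (s + of_int n))) \<longlonglongrightarrow> of_real (c m)"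
      using integral_translates_tendsto[OF h_cont] h by (simp add: has_bochner_integral_iff)
    ultimately have "J = of_real (c m)" by (rule LIMSEQ_unique)
    with J(1) show ?thesis
      by (simp add: F_def infsum_cmult_left' flip: h_eq)
  qed
  have G_coeff: "((\<lambda>s. G s * cis (2 * pi * of_int m * s)) has_integral of_real (c m)) {0..1}" for m
  proof -
    have eq: "\<psi> k s * cis (2 * pi * of_int m * s) = of_real (c k) * cis (2 * pi * of_int (k + m) * s)" for k s
      by (simp add: \<psi>_def cis_mult algebra_simps)
    have int: "((\<lambda>s. \<psi> k s * cis (2 * pi * of_int m * s)) has_integral (if k = - m then of_real (c m) else 0)) {0..1}" for k
    proof -
      have "((\<lambda>s. of_real (c k) * cis (2 * pi * of_int (k + m) * s)) has_integral of_real (c k) * (if k + m = 0 then 1 else 0)) {0..1}"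
        by (intro has_integral_mult_right has_integral_cis_period)
      \<comment> \<open>Integration against frequency \<open>m\<close> singles out the term k = -m;
        evenness of \<open>c\<close> brings its coefficient into the form found for
        \<open>F\<close>.\<close>
      moreover have "c (- m) = c m" by (simp add: c_def)
      ultimately show ?thesis unfolding eq by (cases "k = - m") auto
    qed
    have cont: "continuous_on {0..1} (\<lambda>s. \<psi> k s * cis (2 * pi * of_int m * s))" for k
      unfolding \<psi>_def by (intro continuous_intros)
    have le: "norm (\<psi> k s * cis (2 * pi * of_int m * s)) \<le> c k" for k s
      using \<psi>_le[of k s] by (simp add: norm_mult)
    obtain J where J: "((\<lambda>s. \<Sum>\<^sub>\<infinity>k. \<psi> k s * cis (2 * pi * of_int m * s)) has_integral J) {0..1}"
      "((\<lambda>k. integral {0..1} (\<lambda>s. \<psi> k s * cis (2 * pi * of_int m * s))) has_sum J) UNIV"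
      by (rule has_integral_infsum_Weierstrass[OF cont le c])
    have "((\<lambda>k. if k = - m then of_real (c m) else 0) has_sum J) UNIV"
      using J(2) by (simp add: integral_unique[OF int])
    moreover have "((\<lambda>k. if k = - m then of_real (c m) else 0) has_sum (of_real (c m) :: complex)) UNIV"
      by (rule has_sum_finite_neutralI[of "{- m}"]) auto
    ultimately have "J = of_real (c m)" by (rule has_sum_unique)
    with J(1) show ?thesis
      by (simp add: G_def infsum_cmult_left')
  qed
  have FG: "F u - G u = 0" if "u \<in> {0..1}" for u
  proof (rule continuous_eq_0_if_fourier_coeffs_0[where f = "\<lambda>s. F s - G s", OF _ _ _ that])
    show "continuous_on {0..1} (\<lambda>s. F s - G s)" by (intro continuous_intros F_cont G_cont)
    show "F 0 - G 0 = F 1 - G 1" using F_period[of 0 1] G_period[of 0 1] by simp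
    show "((\<lambda>s. (F s - G s) * cis (2 * pi * of_int m * s)) has_integral 0) {0..1}" for m
      using has_integral_diff[OF F_coeff[of m] G_coeff[of m]] by (simp add: left_diff_distrib)
  qed
  have "F s = F (frac s + of_int \<lfloor>s\<rfloor>)" by (simp add: frac_def)
  also have "\<dots> = G (frac s + of_int \<lfloor>s\<rfloor>)"
    using FG[of "frac s"] by (simp add: F_period G_period frac_lt_1 less_imp_le)
  also have "\<dots> = G s" by (simp add: frac_def)
  finally show ?thesis
    unfolding F_def G_def \<phi>_def \<psi>_def c_def .
qed

text \<open>Completing the square turns the linear term into the shift s = - b / (2 a). On the dual
  side exp (b^2 / (4 a)), the Gaussian weight and the phase recombine into a single square,
  convenient when \<open>b\<close> depends on a further summation index.\<close>

theorem theta_inversion: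
  fixes a b :: real
  assumes a: "a > 0"
  shows "(\<Sum>\<^sub>\<infinity>n::int. of_real (exp (b * of_int n - a * (of_int n)\<^sup>2))) =
         of_real (sqrt (pi / a)) * (\<Sum>\<^sub>\<infinity>m::int. exp ((of_real b - 2 * of_real pi * \<i> * of_int m)\<^sup>2 / of_real (4 * a)))"
proof -
  define s where "s = - b / (2 * a)"
  have "exp (b * of_int n - a * (of_int n)\<^sup>2) = exp (b\<^sup>2 / (4 * a)) * exp (- a * (s + of_int n)\<^sup>2)" for n :: int
    unfolding exp_add[symmetric] using a by (simp add: s_def power2_eq_square field_simps)
  then have "(\<Sum>\<^sub>\<infinity>n::int. of_real (exp (b * of_int n - a * (of_int n)\<^sup>2))) =
      of_real (exp (b\<^sup>2 / (4 * a))) * (\<Sum>\<^sub>\<infinity>n::int. complex_of_real (exp (- a * (s + of_int n)\<^sup>2)))"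
    by (simp only: of_real_mult infsum_cmult_right')
  also have "\<dots> = (\<Sum>\<^sub>\<infinity>m::int. of_real (exp (b\<^sup>2 / (4 * a))) *
      (of_real (sqrt (pi / a) * exp (- (pi * of_int m)\<^sup>2 / a)) * cis (2 * pi * of_int m * s)))"
    unfolding theta_inversion_shift[OF a] by (simp only: infsum_cmult_right')
  also have "\<dots> = (\<Sum>\<^sub>\<infinity>m::int. of_real (sqrt (pi / a)) * exp ((of_real b - 2 * of_real pi * \<i> * of_int m)\<^sup>2 / of_real (4 * a)))"
  proof (rule infsum_cong)
    fix m :: int
    have "(of_real b - 2 * of_real pi * \<i> * of_int m)\<^sup>2 / of_real (4 * a) =
        of_real (b\<^sup>2 / (4 * a)) + (of_real (- (pi * of_int m)\<^sup>2 / a) + \<i> * of_real (2 * pi * of_int m * s))"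
      using a by (simp add: s_def power2_eq_square field_simps)
    then show "of_real (exp (b\<^sup>2 / (4 * a))) *
      (of_real (sqrt (pi / a) * exp (- (pi * of_int m)\<^sup>2 / a)) * cis (2 * pi * of_int m * s)) =
      of_real (sqrt (pi / a)) * exp ((of_real b - 2 * of_real pi * \<i> * of_int m)\<^sup>2 / of_real (4 * a))"
      by (simp only: exp_add of_real_mult exp_of_real cis_conv_exp mult_ac)
  qed
  finally show ?thesis by (simp only: infsum_cmult_right')
qed

section \<open>Infinite q-Pochhammer symbols\<close>

lemma qpoch_inf_has_prod:
  assumes q: "0 < q" "q < 1"
  shows "(\<lambda>j. 1 - a * of_real q ^ j) has_prod qpoch_inf a q"
proof -
  have "summable (\<lambda>j. norm (- a * of_real q ^ j))"
    using q by (simp add: norm_mult norm_power summable_geometric summable_mult)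
  then have "abs_convergent_prod (\<lambda>j. 1 + (- a * of_real q ^ j))"
    by (intro summable_imp_abs_convergent_prod) simp
  then have "convergent_prod (\<lambda>j. 1 - a * of_real q ^ j)"
    using abs_convergent_prod_imp_convergent_prod by force
  then show ?thesis
    unfolding qpoch_inf_def by (rule convergent_prod_has_prod)
qed

lemma qpoch_inf_LIMSEQ:
  assumes q: "0 < q" "q < 1"
  shows "(\<lambda>n. \<Prod>j<n. 1 - a * of_real q ^ j) \<longlonglongrightarrow> qpoch_inf a q"
  using has_prod_imp_tendsto'[OF qpoch_inf_has_prod[OF q]] .

lemma qpoch_inf_eq_0_iff:
  assumes q: "0 < q" "q < 1"
  shows "qpoch_inf a q = 0 \<longleftrightarrow> (\<exists>j. a * of_real q ^ j = 1)"
  using has_prod_eq_0_iff[OF qpoch_inf_has_prod[OF q, of a]] by auto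

lemma qpoch_inf_shift:
  assumes q: "0 < q" "q < 1"
  shows "qpoch_inf a q = (1 - a) * qpoch_inf (a * of_real q) q"
proof (rule LIMSEQ_unique)
  show "(\<lambda>n. \<Prod>j<Suc n. 1 - a * of_real q ^ j) \<longlonglongrightarrow> qpoch_inf a q"
    using LIMSEQ_Suc[OF qpoch_inf_LIMSEQ[OF q]] .
  have "(\<Prod>j<Suc n. 1 - a * of_real q ^ j) = (1 - a) * (\<Prod>j<n. 1 - (a * of_real q) * of_real q ^ j)" for n
    unfolding prod.lessThan_Suc_shift by (simp add: mult.assoc)
  then show "(\<lambda>n. \<Prod>j<Suc n. 1 - a * of_real q ^ j) \<longlonglongrightarrow> (1 - a) * qpoch_inf (a * of_real q) q"
    by (simp only:) (intro tendsto_mult tendsto_const qpoch_inf_LIMSEQ q)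
qed

lemma qpoch_self_of_nat:
  assumes q: "0 < q" "q < 1"
  shows "qpoch (of_real q) q (real k) = of_real (\<Prod>j=1..k. 1 - q ^ j)"
proof -
  \<comment> \<open>\<open>P k\<close> is the tail of (q;q)_inf after its first k factors. It is
    nonzero, so it can be cancelled.\<close>
  define P where "P k = qpoch_inf (of_real (q ^ Suc k)) q" for k
  have P_nz: "P k \<noteq> 0" for k
  proof -
    have "q ^ Suc k * q ^ j \<noteq> 1" for j
      using q power_Suc_less_one[of q "k + j"] by (simp add: power_add)
    then show ?thesis
      unfolding P_def qpoch_inf_eq_0_iff[OF q] by (metis of_real_eq_1_iff of_real_mult of_real_power)
  qed
  have P_Suc: "P k = (1 - of_real (q ^ Suc k)) * P (Suc k)" for k
    using qpoch_inf_shift[OF q, of "of_real (q ^ Suc k)"] by (simp add: P_def mult_ac)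
  have "qpoch (of_real q) q (real k) = P 0 / P k"
    using q by (simp add: qpoch_def P_def powr_realpow)
  also have "P 0 = of_real (\<Prod>j=1..k. 1 - q ^ j) * P k"
  proof (induction k)
    case (Suc k)
    then show ?case using P_Suc[of k] by (simp add: mult_ac)
  qed simp
  finally show ?thesis using P_nz[of k] by simp
qed

text \<open>The product in the denominator has a zero factor at j = -n - 1, so division by zero
  returns 0. Dividing by that 0 in \<open>L_term\<close> gives 0 again, which removes the negative
  indices from the series with u = q.\<close>

lemma qpoch_self_of_neg:
  assumes q: "0 < q" "q < 1" and n: "n < (0::int)"
  shows "qpoch (of_real q) q (of_int n) = 0"
proof -
  have "q ^ nat (- n - 1) = q powr of_int (- n - 1)"
    using q n by (simp add: powr_realpow[symmetric])
  then have "q * q powr of_int n * q ^ nat (- n - 1) = q powr (1 + of_int n + of_int (- n - 1))"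
    using q by (simp only: powr_add powr_one)
  then have "complex_of_real q * of_real (q powr of_int n) * of_real q ^ nat (- n - 1) = 1"
    using q by (simp flip: of_real_mult of_real_power)
  then have "qpoch_inf (of_real q * of_real (q powr of_int n)) q = 0"
    unfolding qpoch_inf_eq_0_iff[OF q] by blast
  then show ?thesis by (simp add: qpoch_def)
qed

text \<open>The symbols converge to (q;q)_inf, which is nonzero, so their inverses converge and are
  bounded. This bound enters the majorants of both double series.\<close>

lemma norm_inverse_qpoch_self_le:
  assumes q: "0 < q" "q < 1"
  obtains C where "C > 0" "\<And>k. norm (inverse (qpoch (of_real q) q (real k))) \<le> C"
proof -
  have "(\<lambda>n. \<Prod>j<n. 1 - of_real q * of_real q ^ j) \<longlonglongrightarrow> qpoch_inf (of_real q) q"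
    by (rule qpoch_inf_LIMSEQ[OF q])
  moreover have "(\<Prod>j<k. 1 - of_real q * of_real q ^ j) = qpoch (of_real q) q (real k)" for k
    unfolding qpoch_self_of_nat[OF q] by (induction k) auto
  ultimately have "(\<lambda>k. qpoch (of_real q) q (real k)) \<longlonglongrightarrow> qpoch_inf (of_real q) q" by simp
  moreover have "qpoch_inf (of_real q) q \<noteq> 0"
  proof -
    have "q * q ^ j \<noteq> 1" for j
      using q power_Suc_less_one[of q j] by simp
    then show ?thesis
      unfolding qpoch_inf_eq_0_iff[OF q] by (metis of_real_eq_1_iff of_real_mult of_real_power)
  qed
  ultimately have "(\<lambda>k. inverse (qpoch (of_real q) q (real k))) \<longlonglongrightarrow> inverse (qpoch_inf (of_real q) q)"
    by (intro tendsto_inverse)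
  then have "Bseq (\<lambda>k. inverse (qpoch (of_real q) q (real k)))"
    by (intro convergent_imp_Bseq convergentI)
  then show ?thesis using that by (auto simp: Bseq_def)
qed

section \<open>Euler's expansion of the infinite product\<close>

definition euler_coeff :: "real \<Rightarrow> nat \<Rightarrow> complex" where
  "euler_coeff q k = (- 1) ^ k * of_real (q powr (real k * (real k - 1) / 2)) / qpoch (of_real q) q (real k)"

lemma euler_coeff_0 [simp]: "0 < q \<Longrightarrow> q < 1 \<Longrightarrow> euler_coeff q 0 = 1"
  using qpoch_self_of_nat[of q 0] by (simp add: euler_coeff_def)

text \<open>This is the recurrence that the functional equation E(y) = (1 - y) E(q y) imposes on the
  coefficients of a power series E.\<close>

lemma euler_coeff_Suc:
  assumes q: "0 < q" "q < 1"
  shows "euler_coeff q (Suc k) * (1 - of_real q ^ Suc k) = - euler_coeff q k * of_real q ^ k"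
proof -
  have "real (Suc k) * (real (Suc k) - 1) / 2 = real k * (real k - 1) / 2 + real k"
    by (simp add: field_simps)
  then have "q powr (real (Suc k) * (real (Suc k) - 1) / 2) = q powr (real k * (real k - 1) / 2) * q ^ k"
    using q by (simp only: powr_add powr_realpow)
  moreover have "qpoch (of_real q) q (real (Suc k)) = qpoch (of_real q) q (real k) * (1 - of_real q ^ Suc k)"
    unfolding qpoch_self_of_nat[OF q] by simp
  moreover have "1 - of_real q ^ Suc k \<noteq> (0::complex)"
    using q power_Suc_less_one[of q k] by (metis of_real_1 of_real_eq_iff of_real_power eq_iff_diff_eq_0 less_irrefl)
  ultimately show ?thesis
    by (simp add: euler_coeff_def)
qed

lemma norm_euler_coeff_le:
  assumes q: "0 < q" "q < 1"
  obtains C where "C > 0" "\<And>k. norm (euler_coeff q k) \<le> C * q powr (real k * (real k - 1) / 2)"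
proof -
  obtain C where C: "C > 0" "\<And>k. norm (inverse (qpoch (of_real q) q (real k))) \<le> C"
    using norm_inverse_qpoch_self_le[OF q] by blast
  have "norm (euler_coeff q k) = norm (inverse (qpoch (of_real q) q (real k))) * q powr (real k * (real k - 1) / 2)" for k
    by (simp add: euler_coeff_def norm_mult norm_divide norm_power norm_inverse inverse_eq_divide)
  then have "norm (euler_coeff q k) \<le> C * q powr (real k * (real k - 1) / 2)" for k
    using mult_right_mono[OF C(2)[of k], of "q powr (real k * (real k - 1) / 2)"] by simp
  with C(1) that show ?thesis by blast
qed

lemma summable_norm_euler:
  assumes q: "0 < q" "q < 1"
  shows "summable (\<lambda>k. norm (euler_coeff q k * y ^ k))"
proof -
  obtain C where C: "C > 0" "\<And>k. norm (euler_coeff q k) \<le> C * q powr (real k * (real k - 1) / 2)"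
    using norm_euler_coeff_le[OF q] by blast
  \<comment> \<open>Bounding |y| by |y| + 1 gives a positive base, whose powers are exponentials
    even for y = 0. The term - ln q / 2 is the linear part of ln q * k (k - 1) / 2.\<close>
  define b where "b = ln (norm y + 1) - ln q / 2"
  have "(\<lambda>k. C * exp (b * real k - (- ln q / 2) * (real k)\<^sup>2)) summable_on UNIV"
    by (intro summable_on_cmult_right summable_on_gaussian_nat) (use q in simp)
  then have "summable (\<lambda>k. C * exp (b * real k - (- ln q / 2) * (real k)\<^sup>2))"
    by (rule summable_on_imp_summable)
  then show ?thesis
  proof (rule summable_comparison_test'[where N = 0])
    fix k :: nat
    have "norm (norm (euler_coeff q k * y ^ k)) \<le> (C * q powr (real k * (real k - 1) / 2)) * (norm y + 1) ^ k"
      unfolding norm_mult norm_power by (auto intro!: mult_mono C power_mono mult_nonneg_nonneg less_imp_le[OF C(1)])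
    also have "q powr (real k * (real k - 1) / 2) = exp (ln q * (real k * (real k - 1) / 2))"
      using q by (simp add: powr_def)
    also have "(norm y + 1) ^ k = exp (real k * ln (norm y + 1))"
      by (subst exp_of_nat_mult) (simp add: add_nonneg_pos)
    also have "C * exp (ln q * (real k * (real k - 1) / 2)) * exp (real k * ln (norm y + 1)) =
        C * exp (b * real k - (- ln q / 2) * (real k)\<^sup>2)"
      by (simp add: b_def power2_eq_square field_simps flip: exp_add)
    finally show "norm (norm (euler_coeff q k * y ^ k)) \<le> C * exp (b * real k - (- ln q / 2) * (real k)\<^sup>2)" .
  qed
qed

text \<open>Iterating E(y) = (1 - y) E(q y) splits off the partial products of (y;q)_inf and leaves
  E(q^n y), which tends to E(0) = 1 by continuity.\<close>

theorem euler_qpoch_inf_has_sum: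
  assumes q: "0 < q" "q < 1"
  shows "((\<lambda>k. euler_coeff q k * y ^ k) has_sum qpoch_inf y q) UNIV"
proof -
  define E where "E y = (\<Sum>k. euler_coeff q k * y ^ k)" for y
  have sm: "summable (\<lambda>k. euler_coeff q k * y ^ k)" for y
    using summable_norm_euler[OF q] by (rule summable_norm_cancel)
  have E_shift: "E y = (1 - y) * E (of_real q * y)" for y
  proof -
    have "E y - E (of_real q * y) = (\<Sum>k. euler_coeff q k * (1 - of_real q ^ k) * y ^ k)"
      unfolding E_def using sm[of y] sm[of "of_real q * y"]
      by (simp add: suminf_diff power_mult_distrib algebra_simps)
    also have "\<dots> = (\<Sum>k. euler_coeff q (Suc k) * (1 - of_real q ^ Suc k) * y ^ Suc k)"
    proof -
      have "summable (\<lambda>k. euler_coeff q k * (1 - of_real q ^ k) * y ^ k)"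
        using summable_diff[OF sm[of y] sm[of "of_real q * y"]]
        by (simp add: power_mult_distrib algebra_simps)
      from suminf_split_head[OF this] show ?thesis by simp
    qed
    also have "\<dots> = (\<Sum>k. (- y) * (euler_coeff q k * (of_real q * y) ^ k))"
      by (simp only: euler_coeff_Suc[OF q]) (simp add: power_mult_distrib mult_ac)
    also have "\<dots> = - y * E (of_real q * y)"
      unfolding E_def by (rule suminf_mult[OF sm])
    finally show ?thesis by (simp add: algebra_simps)
  qed
  have E_prod: "E y = (\<Prod>j<n. 1 - y * of_real q ^ j) * E (of_real q ^ n * y)" for n
  proof (induction n)
    case (Suc n)
    then show ?case using E_shift[of "of_real q ^ n * y"] by (simp add: mult_ac)
  qed simp
  have "(\<lambda>n. (\<Prod>j<n. 1 - y * of_real q ^ j) * E (of_real q ^ n * y)) \<longlonglongrightarrow> qpoch_inf y q * E 0"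
  proof (intro tendsto_mult qpoch_inf_LIMSEQ q)
    have "isCont E 0"
      unfolding E_def by (rule isCont_powser[where K = 1]) (use sm[of 1] in auto)
    moreover have "(\<lambda>n. of_real q ^ n * y) \<longlonglongrightarrow> 0 * y"
      using q by (intro tendsto_mult tendsto_const LIMSEQ_power_zero) auto
    ultimately show "(\<lambda>n. E (of_real q ^ n * y)) \<longlonglongrightarrow> E 0"
      using isCont_tendsto_compose[of 0 E] by simp
  qed
  then have "(\<lambda>n. E y) \<longlonglongrightarrow> qpoch_inf y q * E 0" by (simp flip: E_prod)
  moreover have "E 0 = 1"
    using q by (simp add: E_def powser_zero)
  ultimately have "E y = qpoch_inf y q"
    by (simp add: LIMSEQ_const_iff)
  then show ?thesis
    using norm_summable_imp_has_sum[OF summable_norm_euler[OF q, of y] summable_sums[OF sm[of y]]]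
    by (simp add: E_def)
qed

section \<open>The double series\<close>

lemma summable_on_times_nonneg:
  fixes f :: "'a \<Rightarrow> real" and g :: "'b \<Rightarrow> real"
  assumes "f summable_on A" "g summable_on B" "\<And>x. f x \<ge> 0" "\<And>y. g y \<ge> 0"
  shows "(\<lambda>(x, y). f x * g y) summable_on A \<times> B"
proof (rule summable_on_SigmaI)
  show "((\<lambda>y. case (x, y) of (x, y) \<Rightarrow> f x * g y) has_sum f x * infsum g B) B" for x
    using has_sum_cmult_right[OF has_sum_infsum[OF assms(2)]] by simp
  show "(\<lambda>x. f x * infsum g B) summable_on A"
    by (rule summable_on_cmult_left[OF assms(1)])
qed (use assms in auto)

text \<open>Used for both double series: a majorant that separates the indices reduces absolute
  convergence to two single sums.\<close>

lemma summable_on_product_bound: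
  fixes h :: "'a \<Rightarrow> 'b \<Rightarrow> complex"
  assumes "f summable_on UNIV" "g summable_on UNIV" "\<And>x. f x \<ge> 0" "\<And>y. g y \<ge> 0"
    and "\<And>x y. norm (h x y) \<le> f x * g y"
  shows "(\<lambda>(x, y). h x y) summable_on UNIV \<times> UNIV"
proof -
  have "(\<lambda>p. norm (case p of (x, y) \<Rightarrow> h x y)) summable_on UNIV \<times> UNIV"
    by (rule Infinite_Sum.abs_summable_on_comparison_test'[OF summable_on_times_nonneg[OF assms(1-4)]])
       (use assms(5) in auto)
  then show ?thesis by (rule abs_summable_summable)
qed

section \<open>Terms of the bilateral series and their quadratic form\<close>

lemma gchoose_2_real: "(r :: real) gchoose 2 = r * (r - 1) / 2"
  by (simp add: gbinomial_prod_rev numeral_2_eq_2)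

text \<open>Dividing by the quotient moves (a q^n;q)_inf to the numerator, where Euler's expansion
  applies. Because y / 0 = 0, this also holds when one of the products vanishes.\<close>

lemma L_term_eq:
  "L_term \<beta> a q w n = w powi n * of_real (q powr (\<beta> * (of_int n * (of_int n - 1) / 2)))
     * qpoch_inf (a * of_real (q powr of_int n)) q / qpoch_inf a q"
  by (simp add: L_term_def qpoch_def gchoose_2_real)

lemma L_term_self_of_nat:
  "L_term \<beta> (of_real q) q w (int k) =
     w ^ k * of_real (q powr (\<beta> * (real k * (real k - 1) / 2))) / qpoch (of_real q) q (real k)"
  by (simp add: L_term_def gchoose_2_real)

lemma L_term_self_has_sum_iff:
  assumes q: "0 < q" "q < 1"
  shows "(L_term \<beta> (of_real q) q w has_sum S) UNIV \<longleftrightarrow>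
         ((\<lambda>k. L_term \<beta> (of_real q) q w (int k)) has_sum S) UNIV"
proof -
  have "(L_term \<beta> (of_real q) q w has_sum S) UNIV \<longleftrightarrow> (L_term \<beta> (of_real q) q w has_sum S) (range int)"
  proof (rule has_sum_cong_neutral)
    fix n assume "n \<in> UNIV - range int"
    then have "n < 0" by (metis DiffD2 nonneg_int_cases not_le rangeI)
    then show "L_term \<beta> (of_real q) q w n = 0"
      by (simp add: L_term_def qpoch_self_of_neg[OF q])
  qed auto
  also have "\<dots> \<longleftrightarrow> ((\<lambda>k. L_term \<beta> (of_real q) q w (int k)) has_sum S) UNIV"
    by (subst has_sum_reindex) (auto simp: o_def)
  finally show ?thesis .
qed

text \<open>Both diagonal coefficients are positive for \<alpha> > 1 and are chosen so that the
  difference of the two sides is a perfect square. Removing the cross term lets the majorant factor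
  into a part in \<open>n\<close> and a part in \<open>k\<close>.\<close>

lemma quadratic_form_lower_bound:
  fixes \<alpha> n k :: real
  assumes \<alpha>: "\<alpha> > 1"
  shows "(\<alpha> - 1) / 4 * n\<^sup>2 + (\<alpha> - 1) / (2 * (\<alpha> + 1)) * k\<^sup>2 \<le> \<alpha> * n\<^sup>2 / 2 + n * k + k\<^sup>2 / 2"
proof -
  have "0 \<le> ((\<alpha> + 1) * n + 2 * k)\<^sup>2 / (4 * (\<alpha> + 1))" using \<alpha> by simp
  also have "\<dots> = (\<alpha> * n\<^sup>2 / 2 + n * k + k\<^sup>2 / 2) - ((\<alpha> - 1) / 4 * n\<^sup>2 + (\<alpha> - 1) / (2 * (\<alpha> + 1)) * k\<^sup>2)"
    using \<alpha> by (simp add: field_simps power2_eq_square add_pos_pos)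
  finally show ?thesis by simp
qed

text \<open>
  With \<open>l = ln z\<close> and \<open>J = \<pi> i m\<close>: the exponent of the inverted theta series, regrouped into the prefactor,
  the powers making up the \<open>k\<close>-th term of the series on the right, and the Gaussian weight. The last
  summand \<open>- 2 J\<close> is a period of the exponential function.
\<close>

lemma exponent_identity:
  fixes \<alpha> t l k J :: complex
  assumes "\<alpha> \<noteq> 0" "t \<noteq> 0"
  shows "- t * (k * (k - 1) / 2) + k * l + (\<alpha> * l + \<alpha> * t / 2 - t * k - 2 * J)\<^sup>2 / (2 * \<alpha> * t) =
    (\<alpha> * l\<^sup>2 / (2 * t) + \<alpha> * l / 2 + \<alpha> * t / 8) + k * (2 * J / \<alpha>) + k * (- t * (1 / 2 * (1 - 1 / \<alpha>)))
    - t * ((1 - 1 / \<alpha>) * (k * (k - 1) / 2)) + (2 * J * (1 / 2 - 1 / t * l) + 2 * J\<^sup>2 / (\<alpha> * t)) - 2 * J"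
  using assms by (simp add: field_simps power2_eq_square)

text \<open>An \<open>infsum\<close> over a family that is not summable is 0 by default, so the
  identity is stated together with summability of every series in it. If (z x;q)_inf = 0, both sides
  of the identity are 0 by the convention for division.\<close>

theorem theorem1p2:
  fixes z t q \<alpha> :: real and x :: complex
  defines "w \<equiv> \<lambda>n::int. - exp (2 * of_real pi * \<i> * of_int n / of_real \<alpha>) * x
                            * of_real (q powr (1 / 2 * (1 - 1 / \<alpha>)))"
    and "g \<equiv> \<lambda>n::int. exp (2 * of_real pi * \<i> * of_int n * of_real (1 / 2 - 1 / t * ln z)
                            - of_real (2 * pi\<^sup>2 * (of_int n)\<^sup>2 / (\<alpha> * t)))"
  assumes "z > 0" and "t > 0" and "q = exp (- t)" and "\<alpha> > 1"
  shows "L_term \<alpha> (of_real z * x) q (of_real (z powr \<alpha>)) summable_on UNIV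
    \<and> (\<forall>n. L_term (1 - 1 / \<alpha>) (of_real q) q (w n) summable_on UNIV)
    \<and> (\<lambda>n. L_fun (1 - 1 / \<alpha>) (of_real q) q (w n) * g n) summable_on UNIV
    \<and> L_fun \<alpha> (of_real z * x) q (of_real (z powr \<alpha>))
      = of_real ((2 * pi * z powr \<alpha>) powr (1 / 2)
                 * exp (\<alpha> * t / 8 + \<alpha> / (2 * t) * (ln z)\<^sup>2))
        / (of_real ((\<alpha> * t) powr (1 / 2)) * qpoch_inf (of_real z * x) q)
        * (\<Sum>\<^sub>\<infinity>n\<in>UNIV. L_fun (1 - 1 / \<alpha>) (of_real q) q (w n) * g n)"
proof -
  note z = \<open>z > 0\<close> and t = \<open>t > 0\<close> and \<alpha> = \<open>\<alpha> > 1\<close>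
  have q: "0 < q" "q < 1" using t by (simp_all add: \<open>q = exp (- t)\<close>)
  have q_powr: "q powr r = exp (- t * r)" for r
    by (simp add: \<open>q = exp (- t)\<close> powr_def)
  define u where "u = of_real z * x"
  define \<beta> where "\<beta> = 1 - 1 / \<alpha>"
  have \<beta>: "\<beta> > 0" using \<alpha> by (simp add: \<beta>_def)
  define P where "P = (\<lambda>y. qpoch_inf y q)"
  \<comment> \<open>\<open>W n\<close> is z^(\<alpha> n) q^(\<alpha> n (n - 1) / 2) as one
    exponential. Summed over \<open>k\<close>, \<open>A n k\<close> gives the n-th term on the left
    without its factor 1 / (u;q)_inf, and \<open>B k m\<close> gives the m-th term on the
    right.\<close>
  define W where "W = (\<lambda>n::int. exp (of_int n * (\<alpha> * ln z) - t * (\<alpha> * (of_int n * (of_int n - 1) / 2))))"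
  define A where "A = (\<lambda>(n::int) (k::nat). of_real (W n) * (euler_coeff q k * (u * of_real (q powr of_int n)) ^ k))"
  define B where "B = (\<lambda>(k::nat) (m::int). L_term \<beta> (of_real q) q (w m) (int k) * g m)"
  define K where "K = sqrt (2 * pi / (\<alpha> * t)) * exp (\<alpha> * (ln z)\<^sup>2 / (2 * t) + \<alpha> * ln z / 2 + \<alpha> * t / 8)"

  have A_sum: "(\<lambda>(n, k). A n k) summable_on UNIV \<times> UNIV"
  proof -
    obtain C where C: "C > 0" "\<And>k. norm (euler_coeff q k) \<le> C * q powr (real k * (real k - 1) / 2)"
      using norm_euler_coeff_le[OF q] by blast
    \<comment> \<open>\<open>b\<close> and \<open>d\<close> bound the linear parts of the exponent
      in \<open>n\<close> and \<open>k\<close>; the Gaussian rates below are \<open>t\<close> times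
      the coefficients of \<open>quadratic_form_lower_bound\<close>.\<close>
    define b d where "b = \<bar>\<alpha> * ln z + t * \<alpha> / 2\<bar>" and "d = t / 2 + ln (norm u + 1)"
    define f where "f = (\<lambda>n::int. C * exp (b * \<bar>of_int n\<bar> - (t * ((\<alpha> - 1) / 4)) * (of_int n)\<^sup>2))"
    define h where "h = (\<lambda>k::nat. exp (d * real k - (t * ((\<alpha> - 1) / (2 * (\<alpha> + 1)))) * (real k)\<^sup>2))"
    have "norm (A n k) \<le> f n * h k" for n k
    proof -
      define N where "N = real_of_int n"
      have "norm (A n k) = W n * (norm (euler_coeff q k) * (norm u ^ k * (q powr N) ^ k))"
        by (simp add: A_def W_def N_def norm_mult norm_power power_mult_distrib)
      also have "\<dots> \<le> W n * ((C * q powr (real k * (real k - 1) / 2)) * ((norm u + 1) ^ k * (q powr N) ^ k))"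
        using C by (intro mult_left_mono mult_mono power_mono) (auto simp: W_def)
      also have "(norm u + 1) ^ k = exp (real k * ln (norm u + 1))"
        by (subst exp_of_nat_mult) (simp add: add_nonneg_pos)
      also have "(q powr N) ^ k = exp (real k * (- t * N))"
        by (subst exp_of_nat_mult) (simp add: q_powr)
      also have "W n * ((C * q powr (real k * (real k - 1) / 2)) * (exp (real k * ln (norm u + 1)) * exp (real k * (- t * N)))) =
          C * exp ((N * (\<alpha> * ln z) - t * (\<alpha> * (N * (N - 1) / 2))) + (- t * (real k * (real k - 1) / 2)
            + (real k * ln (norm u + 1) + real k * (- t * N))))"
        unfolding q_powr exp_add W_def N_def by (simp only: mult_ac)
      also have "\<dots> \<le> C * exp ((b * \<bar>N\<bar> - (t * ((\<alpha> - 1) / 4)) * N\<^sup>2) +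
            (d * real k - (t * ((\<alpha> - 1) / (2 * (\<alpha> + 1)))) * (real k)\<^sup>2))"
      proof -
        have "N * (\<alpha> * ln z + t * \<alpha> / 2) \<le> b * \<bar>N\<bar>"
          unfolding b_def by (metis abs_ge_self abs_mult mult.commute)
        moreover have "t * ((\<alpha> - 1) / 4 * N\<^sup>2 + (\<alpha> - 1) / (2 * (\<alpha> + 1)) * (real k)\<^sup>2)
            \<le> t * (\<alpha> * N\<^sup>2 / 2 + N * real k + (real k)\<^sup>2 / 2)"
          using quadratic_form_lower_bound[OF \<alpha>] t by (intro mult_left_mono) auto
        moreover have "(N * (\<alpha> * ln z) - t * (\<alpha> * (N * (N - 1) / 2))) + (- t * (real k * (real k - 1) / 2)
            + (real k * ln (norm u + 1) + real k * (- t * N))) =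
            N * (\<alpha> * ln z + t * \<alpha> / 2) + d * real k - t * (\<alpha> * N\<^sup>2 / 2 + N * real k + (real k)\<^sup>2 / 2)"
          by (simp add: d_def power2_eq_square field_simps)
        ultimately show ?thesis
          using C(1) by (simp add: algebra_simps)
      qed
      also have "\<dots> = f n * h k"
        unfolding exp_add f_def h_def N_def by (simp only: mult.assoc)
      finally show ?thesis .
    qed
    moreover have "f summable_on UNIV"
      unfolding f_def by (intro summable_on_cmult_right summable_on_gaussian_int) (use t \<alpha> in simp)
    moreover have "h summable_on UNIV"
      unfolding h_def by (intro summable_on_gaussian_nat) (use t \<alpha> in simp)
    ultimately show ?thesis
      using C(1) by (intro summable_on_product_bound[of f h]) (auto simp: f_def h_def)
  qed

  have B_sum: "(\<lambda>(k, m). B k m) summable_on UNIV \<times> UNIV"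
  proof -
    obtain C where C: "C > 0" "\<And>k. norm (inverse (qpoch (of_real q) q (real k))) \<le> C"
      using norm_inverse_qpoch_self_le[OF q] by blast
    define f where "f = (\<lambda>k::nat. C * exp (ln (norm x + 1) * real k - (t * \<beta> / 2) * (real k)\<^sup>2))"
    define h where "h = (\<lambda>m::int. exp (0 * \<bar>of_int m\<bar> - (2 * pi\<^sup>2 / (\<alpha> * t)) * (of_int m)\<^sup>2))"
    have "norm (B k m) \<le> f k * h m" for k m
    proof -
      \<comment> \<open>The phase in \<open>w m\<close> has modulus 1, so taking norms already
        separates \<open>k\<close> from \<open>m\<close>. The k-th power of exp (- t \<beta> / 2)
        completes k (k - 1) / 2 to k^2 / 2, leaving a Gaussian in \<open>k\<close> with positive
        rate t \<beta> / 2.\<close>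
      have norm_w: "norm (w m) = norm x * exp (- t * (\<beta> / 2))"
        by (simp add: w_def norm_mult q_powr \<beta>_def)
      have norm_g: "norm (g m) = h m"
        by (simp add: g_def h_def)
      have "norm (B k m) = norm (inverse (qpoch (of_real q) q (real k))) *
          (norm x ^ k * (exp (- t * (\<beta> / 2)) ^ k * exp (- t * (\<beta> * (real k * (real k - 1) / 2))))) * h m"
        by (simp add: B_def L_term_self_of_nat norm_mult norm_divide norm_power norm_w norm_g q_powr
              power_mult_distrib norm_inverse inverse_eq_divide)
      also have "\<dots> \<le> C * ((norm x + 1) ^ k * (exp (- t * (\<beta> / 2)) ^ k * exp (- t * (\<beta> * (real k * (real k - 1) / 2))))) * h m"
        using C by (intro mult_right_mono mult_mono power_mono) (auto simp: h_def)
      also have "(norm x + 1) ^ k = exp (real k * ln (norm x + 1))"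
        by (subst exp_of_nat_mult) (simp add: add_nonneg_pos)
      also have "exp (real k * ln (norm x + 1)) * (exp (- t * (\<beta> / 2)) ^ k * exp (- t * (\<beta> * (real k * (real k - 1) / 2)))) =
          exp (ln (norm x + 1) * real k - (t * \<beta> / 2) * (real k)\<^sup>2)"
        unfolding exp_of_nat_mult[symmetric] exp_add[symmetric]
        by (simp add: power2_eq_square field_simps)
      finally show ?thesis by (simp add: f_def)
    qed
    moreover have "f summable_on UNIV"
      unfolding f_def by (intro summable_on_cmult_right summable_on_gaussian_nat) (use t \<beta> in simp)
    moreover have "h summable_on UNIV"
      unfolding h_def by (intro summable_on_gaussian_int) (use t \<alpha> in simp)
    ultimately show ?thesis
      using C(1) by (intro summable_on_product_bound[of f h]) (auto simp: f_def h_def)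
  qed

  have A_row: "(A n has_sum of_real (W n) * P (u * of_real (q powr of_int n))) UNIV" for n
    unfolding A_def P_def by (intro has_sum_cmult_right euler_qpoch_inf_has_sum q)

  have L_term_A: "L_term \<alpha> u q (of_real (z powr \<alpha>)) n = infsum (A n) UNIV / P u" for n
  proof -
    have "z powr \<alpha> = exp (\<alpha> * ln z)" using z by (simp add: powr_def)
    then have "complex_of_real (z powr \<alpha>) powi n = of_real (exp (of_int n * (\<alpha> * ln z)))"
      by (simp add: exp_power_int flip: of_real_power_int)
    moreover have "W n = exp (of_int n * (\<alpha> * ln z)) * q powr (\<alpha> * (of_int n * (of_int n - 1) / 2))"
      unfolding W_def q_powr exp_add[symmetric] by simp
    ultimately show ?thesis
      unfolding L_term_eq infsumI[OF A_row] P_def by (simp only: of_real_mult)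
  qed

  have A_column: "(\<Sum>\<^sub>\<infinity>n. A n k) = of_real K * (\<Sum>\<^sub>\<infinity>m. B k m)" for k
  proof -
    \<comment> \<open>For fixed \<open>k\<close> the column is a theta series whose quadratic rate
      \<alpha> t / 2 does not depend on \<open>k\<close>; only the linear coefficient
      \<open>b\<close> does.\<close>
    define b where "b = \<alpha> * ln z + \<alpha> * t / 2 - t * real k"
    have A_eq: "A n k = euler_coeff q k * u ^ k * of_real (exp (b * of_int n - (\<alpha> * t / 2) * (of_int n)\<^sup>2))" for n
    proof -
      have "of_real (q powr of_int n) ^ k = (of_real (exp (real k * (- t * of_int n))) :: complex)"
        unfolding q_powr exp_of_nat_mult of_real_power ..
      moreover have "exp (b * of_int n - (\<alpha> * t / 2) * (of_int n)\<^sup>2) = W n * exp (real k * (- t * of_int n))"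
        unfolding W_def exp_add[symmetric] by (simp add: b_def power2_eq_square field_simps)
      ultimately show ?thesis
        unfolding A_def by (simp only: power_mult_distrib of_real_mult mult_ac)
    qed
    have term_eq: "euler_coeff q k * u ^ k * exp ((of_real b - 2 * of_real pi * \<i> * of_int m)\<^sup>2 / of_real (4 * (\<alpha> * t / 2))) =
        of_real (exp (\<alpha> * (ln z)\<^sup>2 / (2 * t) + \<alpha> * ln z / 2 + \<alpha> * t / 8)) * B k m" for m
    proof -
      define l where "l = ln z"
      define J where "J = of_real pi * \<i> * of_int m"
      \<comment> \<open>Complex copies of the real parameters make \<open>exponent_identity\<close>
        applicable to the exponents as a field identity.\<close>
      define a T L :: complex where "a = of_real \<alpha>" and "T = of_real t" and "L = of_real l"
      define k' where "k' = (of_nat k :: complex)"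
      define Q where "Q = qpoch (of_real q) q (real k)"
      define E1 where "E1 = (a * L\<^sup>2 / (2 * T) + a * L / 2 + a * T / 8)"
      define E2 where "E2 = (2 * J * (1 / 2 - 1 / T * L) + 2 * J\<^sup>2 / (a * T))"
      have nz: "a \<noteq> 0" "T \<noteq> 0" using \<alpha> t by (simp_all add: a_def T_def)
      have exp_J: "exp (- 2 * J) = 1"
        unfolding J_def exp_eq_1 by (auto intro!: exI[of _ "- m"])
      have "z = exp l" using z by (simp add: l_def)
      then have z_k: "of_real z ^ k = exp (k' * L)"
        by (simp add: k'_def L_def exp_of_nat_mult exp_of_real)
      have lhs: "euler_coeff q k * u ^ k * exp ((of_real b - 2 * of_real pi * \<i> * of_int m)\<^sup>2 / of_real (4 * (\<alpha> * t / 2))) =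
          (- 1) ^ k * x ^ k / Q * exp (- T * (k' * (k' - 1) / 2) + k' * L + (a * L + a * T / 2 - T * k' - 2 * J)\<^sup>2 / (2 * a * T))"
      proof -
        have "complex_of_real (q powr (real k * (real k - 1) / 2)) = exp (- T * (k' * (k' - 1) / 2))"
          unfolding q_powr exp_of_real[symmetric] by (simp add: T_def k'_def)
        moreover have "(of_real b - 2 * of_real pi * \<i> * of_int m)\<^sup>2 / of_real (4 * (\<alpha> * t / 2)) =
            (a * L + a * T / 2 - T * k' - 2 * J)\<^sup>2 / (2 * a * T)"
          by (simp add: b_def a_def L_def T_def k'_def J_def l_def mult_ac)
        ultimately show ?thesis
          unfolding euler_coeff_def u_def Q_def[symmetric] by (simp only: power_mult_distrib z_k exp_add times_divide_eq_left times_divide_eq_right mult_ac)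
      qed
      \<comment> \<open>The minus sign in \<open>w m\<close> matches the sign (-1)^k of Euler's
        coefficients.\<close>
      have w_k: "w m ^ k = (- 1) ^ k * x ^ k * (exp (k' * (2 * J / a)) * exp (k' * (- T * (1 / 2 * (1 - 1 / a)))))"
      proof -
        have "of_real (q powr (1 / 2 * (1 - 1 / \<alpha>))) = exp (- T * (1 / 2 * (1 - 1 / a)))"
          unfolding q_powr exp_of_real[symmetric] by (simp add: T_def a_def)
        then have "w m = (- 1) * x * (exp (2 * J / a) * exp (- T * (1 / 2 * (1 - 1 / a))))"
          unfolding w_def by (simp add: J_def a_def mult_ac)
        then show ?thesis
          by (simp only: power_mult_distrib k'_def exp_of_nat_mult)
      qed
      have g_m: "g m = exp E2"
        by (simp add: g_def E2_def J_def T_def L_def a_def l_def power_mult_distrib algebra_simps)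
      have q_k: "complex_of_real (q powr (\<beta> * (real k * (real k - 1) / 2))) = exp (- (T * ((1 - 1 / a) * (k' * (k' - 1) / 2))))"
        unfolding q_powr exp_of_real[symmetric] by (simp add: T_def k'_def a_def \<beta>_def)
      have "of_real (exp (\<alpha> * (ln z)\<^sup>2 / (2 * t) + \<alpha> * ln z / 2 + \<alpha> * t / 8)) = exp E1"
        unfolding exp_of_real[symmetric] by (simp add: E1_def a_def L_def T_def l_def)
      \<comment> \<open>The factor exp (- 2 J) = 1 is inserted to match the last summand in
        \<open>exponent_identity\<close>.\<close>
      then have rhs: "of_real (exp (\<alpha> * (ln z)\<^sup>2 / (2 * t) + \<alpha> * ln z / 2 + \<alpha> * t / 8)) * B k m =
          (- 1) ^ k * x ^ k / Q * (exp E1 * exp (k' * (2 * J / a)) * exp (k' * (- T * (1 / 2 * (1 - 1 / a))))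
            * exp (- (T * ((1 - 1 / a) * (k' * (k' - 1) / 2)))) * exp E2 * exp (- 2 * J))"
        unfolding B_def L_term_self_of_nat w_k g_m q_k Q_def[symmetric] exp_J by simp
      show ?thesis
        unfolding lhs rhs exp_add[symmetric] exponent_identity[OF nz]
        by (simp add: E1_def E2_def)
    qed
    have "(\<Sum>\<^sub>\<infinity>n. A n k) = euler_coeff q k * u ^ k * (\<Sum>\<^sub>\<infinity>n::int. of_real (exp (b * of_int n - (\<alpha> * t / 2) * (of_int n)\<^sup>2)))"
      unfolding A_eq by (rule infsum_cmult_right')
    also have "\<dots> = of_real (sqrt (pi / (\<alpha> * t / 2))) * (\<Sum>\<^sub>\<infinity>m::int. euler_coeff q k * u ^ k *
        exp ((of_real b - 2 * of_real pi * \<i> * of_int m)\<^sup>2 / of_real (4 * (\<alpha> * t / 2))))"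
      using t \<alpha> by (subst theta_inversion) (simp_all only: infsum_cmult_right' mult_ac, simp)
    also have "\<dots> = of_real (sqrt (pi / (\<alpha> * t / 2))) *
        (of_real (exp (\<alpha> * (ln z)\<^sup>2 / (2 * t) + \<alpha> * ln z / 2 + \<alpha> * t / 8)) * (\<Sum>\<^sub>\<infinity>m. B k m))"
      by (simp only: term_eq infsum_cmult_right')
    also have "\<dots> = of_real K * (\<Sum>\<^sub>\<infinity>m. B k m)"
      by (simp add: K_def mult_ac)
    finally show ?thesis .
  qed

  have B_col_sum: "(\<lambda>k. B k m) summable_on UNIV" for m
    using summable_on_SigmaD1[of "\<lambda>m k. B k m" UNIV "\<lambda>_. UNIV" m] summable_on_swap[of "\<lambda>(k, m). B k m" UNIV UNIV] B_sum
    by simp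
  \<comment> \<open>A nonzero weight can be cancelled, so summability of \<open>B k m\<close> over
    \<open>k\<close> passes to the series without \<open>g m\<close>.\<close>
  have g_nz: "g m \<noteq> 0" for m by (simp add: g_def)
  have L_sum: "L_term \<beta> (of_real q) q (w m) summable_on UNIV" for m
  proof -
    have "(\<lambda>k. L_term \<beta> (of_real q) q (w m) (int k)) summable_on UNIV"
      using B_col_sum[of m] g_nz[of m] by (simp add: B_def summable_on_cmult_left')
    then show ?thesis
      unfolding summable_on_def L_term_self_has_sum_iff[OF q] .
  qed
  have B_column: "(\<Sum>\<^sub>\<infinity>k. B k m) = L_fun \<beta> (of_real q) q (w m) * g m" for m
  proof -
    have "((\<lambda>k. L_term \<beta> (of_real q) q (w m) (int k)) has_sum L_fun \<beta> (of_real q) q (w m)) UNIV"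
      using has_sum_infsum[OF L_sum[of m]] by (simp add: L_fun_def L_term_self_has_sum_iff[OF q])
    then show ?thesis
      unfolding B_def by (intro infsumI has_sum_cmult_left)
  qed

  have "(\<lambda>n. infsum (A n) UNIV) summable_on UNIV"
    using summable_on_Sigma_banach[of A UNIV "\<lambda>_. UNIV"] A_sum by simp
  then have sum1: "L_term \<alpha> u q (of_real (z powr \<alpha>)) summable_on UNIV"
    unfolding L_term_A[abs_def] by (simp only: divide_inverse summable_on_cmult_left)
  have sum3: "(\<lambda>n. L_fun \<beta> (of_real q) q (w n) * g n) summable_on UNIV"
    using summable_on_Sigma_banach[of "\<lambda>m k. B k m" UNIV "\<lambda>_. UNIV"] summable_on_swap[of "\<lambda>(k, m). B k m" UNIV UNIV] B_sum
    by (simp add: B_column)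
  have "L_fun \<alpha> u q (of_real (z powr \<alpha>)) = (\<Sum>\<^sub>\<infinity>n. infsum (A n) UNIV) / P u"
    unfolding L_fun_def L_term_A by (simp only: divide_inverse infsum_cmult_left')
  also have "(\<Sum>\<^sub>\<infinity>n. infsum (A n) UNIV) = (\<Sum>\<^sub>\<infinity>k. \<Sum>\<^sub>\<infinity>n. A n k)"
    by (rule infsum_swap_banach[OF A_sum])
  also have "\<dots> = of_real K * (\<Sum>\<^sub>\<infinity>k. \<Sum>\<^sub>\<infinity>m. B k m)"
    unfolding A_column by (rule infsum_cmult_right')
  also have "(\<Sum>\<^sub>\<infinity>k. \<Sum>\<^sub>\<infinity>m. B k m) = (\<Sum>\<^sub>\<infinity>m. L_fun \<beta> (of_real q) q (w m) * g m)"
    unfolding B_column[symmetric] by (rule infsum_swap_banach[OF B_sum])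
  finally have main: "L_fun \<alpha> u q (of_real (z powr \<alpha>)) =
      of_real K * (\<Sum>\<^sub>\<infinity>m. L_fun \<beta> (of_real q) q (w m) * g m) / P u" .
  \<comment> \<open>The summand \<alpha> ln z / 2 in the exponent of \<open>K\<close> is the factor
    (z^\<alpha>)^(1/2) of the stated prefactor.\<close>
  have K: "K = (2 * pi * z powr \<alpha>) powr (1 / 2) * exp (\<alpha> * t / 8 + \<alpha> / (2 * t) * (ln z)\<^sup>2) / (\<alpha> * t) powr (1 / 2)"
  proof -
    have "(z powr \<alpha>) powr (1 / 2) = exp (\<alpha> * ln z / 2)"
      using z by (simp add: powr_def)
    then have "(2 * pi * z powr \<alpha>) powr (1 / 2) = sqrt (2 * pi) * exp (\<alpha> * ln z / 2)"
      by (simp add: powr_mult powr_half_sqrt real_sqrt_mult)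
    moreover have "(\<alpha> * t) powr (1 / 2) = sqrt (\<alpha> * t)"
      using \<alpha> t by (simp add: powr_half_sqrt)
    ultimately show ?thesis
      unfolding K_def exp_add by (simp add: real_sqrt_divide)
  qed
  show ?thesis
    using sum1 L_sum sum3 main unfolding K u_def \<beta>_def P_def by simp
qed

end
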